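(* Let $S$ be a semigroup. Then the following statements are equivalent: (i) $\pi(S)\subseteq\{1,2\}$; (ii) $\Gamma(S)$ is acyclic; (iii) $\Gamma(S)$ is bipartite.
   Context: For a subset $X$ of a semigroup $S$, $\langle X\rangle$ denotes the subsemigroup generated by $X$; a semigroup is monogenic if it equals $\langle a\rangle=\{a^k : k\in\mathbb{N}\}$ for some element $a$, where $\mathbb{N}=\{1,2,\dots\}$. The cyclic graph $\Gamma(S)$ is the simple undirected graph with vertex set $S$ in which two distinct vertices $x,y$ are adjacent if and only if $\langle x,y\rangle$ is a monogenic subsemigroup of $S$. The order of $a\in S$ is $o(a)=|\langle a\rangle|$ (possibly infinite), and $\pi(S)=\{o(a): a\in S\}$ is the set of orders of all elements of $S$. A graph is bipartite if its vertex set is the union of two disjoint independent sets. *)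

theory Defs
  imports "Graph_Theory.Pair_Digraph" "HOL-Library.Extended_Nat"
begin

definition subsemigroup :: "'a::semigroup_mult set \<Rightarrow> bool" where
  "subsemigroup T \<longleftrightarrow> (\<forall>x\<in>T. \<forall>y\<in>T. x * y \<in> T)"

definition generated :: "'a::semigroup_mult set \<Rightarrow> 'a set" where
  "generated X = subsemigroup hull X"

definition monogenic :: "'a::semigroup_mult set \<Rightarrow> bool" where
  "monogenic T \<longleftrightarrow> (\<exists>a. T = generated {a})"

definition element_order :: "'a::semigroup_mult \<Rightarrow> enat" where
  "element_order a =
     (if finite (generated {a}) then enat (card (generated {a})) else \<infinity>)"

text \<open>
  A simple undirected graph is represented as a loop-free symmetric digraph whose arcs are
  the ordered pairs of adjacent vertices.
\<close>

definition cyclic_graph :: "'a::semigroup_mult pair_pre_digraph" where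
  "cyclic_graph = \<lparr> pverts = UNIV, parcs = {(x, y). x \<noteq> y \<and> monogenic (generated {x, y})} \<rparr>"

text \<open>
  In a symmetric digraph, \<open>pre_digraph.cycle\<close> also counts the closed walks \<open>a, b, a\<close> along a
  single edge. The length bound excludes them, leaving the cycles of the undirected graph.
\<close>

definition acyclic_graph :: "'a pair_pre_digraph \<Rightarrow> bool" where
  "acyclic_graph G \<longleftrightarrow> \<not> (\<exists>p. pre_digraph.cycle (with_proj G) p \<and> 3 \<le> length p)"

definition independent_in :: "'a pair_pre_digraph \<Rightarrow> 'a set \<Rightarrow> bool" where
  "independent_in G A \<longleftrightarrow> A \<subseteq> pverts G \<and> (\<forall>x\<in>A. \<forall>y\<in>A. (x, y) \<notin> parcs G)"

text \<open>The two parts may be empty, so an edgeless graph is bipartite.\<close>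

definition bipartite_graph :: "'a pair_pre_digraph \<Rightarrow> bool" where
  "bipartite_graph G \<longleftrightarrow>
     (\<exists>A B. pverts G = A \<union> B \<and> A \<inter> B = {} \<and> independent_in G A \<and> independent_in G B)"

lemma subsemigroup_generated: "subsemigroup (generated X)"
  unfolding generated_def by (rule hull_in) (auto simp: subsemigroup_def)

text \<open>The class \<open>semigroup_mult\<close> has no powers; \<open>((*) a ^^ k) a\<close> is the power of \<open>a\<close> with exponent \<open>k + 1\<close>.\<close>

lemma generated_singleton: "generated {a} = range (\<lambda>k. ((*) a ^^ k) a)"
proof
  have mult: "((*) a ^^ j) a * ((*) a ^^ k) a = ((*) a ^^ Suc (j + k)) a" for j k
    by (induction j) (simp_all add: mult.assoc)
  have "subsemigroup (range (\<lambda>k. ((*) a ^^ k) a))"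
    unfolding subsemigroup_def using mult by blast
  moreover have "{a} \<subseteq> range (\<lambda>k. ((*) a ^^ k) a)"
    using rangeI[of "\<lambda>k. ((*) a ^^ k) a" 0] by simp
  ultimately show "generated {a} \<subseteq> range (\<lambda>k. ((*) a ^^ k) a)"
    unfolding generated_def by (intro hull_minimal)
next
  have a: "a \<in> generated {a}"
    unfolding generated_def by (rule hull_inc) simp
  have "((*) a ^^ k) a \<in> generated {a}" for k
    using a subsemigroup_generated[of "{a}"]
    by (induction k) (auto simp: subsemigroup_def)
  then show "range (\<lambda>k. ((*) a ^^ k) a) \<subseteq> generated {a}"
    by blast
qed

lemma pair_sym_digraph_cyclic_graph: "pair_sym_digraph cyclic_graph"
  by unfold_locales
    (auto simp: cyclic_graph_def symmetric_def arcs_ends_def arc_to_ends_def sym_def insert_commute)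

lemma pair_loopfree_digraph_cyclic_graph: "pair_loopfree_digraph cyclic_graph"
  by unfold_locales (auto simp: cyclic_graph_def)

end

theory Submission
  imports Defs
begin

text \<open>
  Everything is governed by the cube of an element: \<open>a\<close> has order at most \<open>2\<close> exactly when
  \<open>a\<^sup>3 \<in> {a, a\<^sup>2}\<close> (\<open>element_order_le_2_iff\<close>).

  If \<open>a\<^sup>3 \<notin> {a, a\<^sup>2}\<close>, then the graph contains a triangle (\<open>triangle_if_cube_new\<close>), namely
  \<open>a, a\<^sup>2, a\<^sup>3\<close> when \<open>a\<close> has order \<open>3\<close> and \<open>a, a\<^sup>2, a\<^sup>4\<close> otherwise. A triangle is a cycle, and no
  triangle has a bipartition, so either of acyclicity and bipartiteness forces
  \<open>\<pi>(S) \<subseteq> {1, 2}\<close>.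

  Conversely, if \<open>\<pi>(S) \<subseteq> {1, 2}\<close>, then every edge has the form \<open>c, c\<^sup>2\<close>, where \<open>c\<close> is not
  idempotent but \<open>c\<^sup>2\<close> is (\<open>edge_is_square\<close>). Hence the idempotents and the non-idempotents form
  a bipartition. Moreover, the only neighbour of a non-idempotent \<open>c\<close> is \<open>c\<^sup>2\<close>, so the graph is
  a disjoint union of stars centred at the idempotents. In a cycle all vertices have two distinct
  neighbours, yet one of any two consecutive vertices is not idempotent.
\<close>

section \<open>Monogenic subsemigroups and elements of order at most two\<close>

lemma generated_incl: "X \<subseteq> generated X"
  unfolding generated_def by (rule hull_subset)

lemma generated_mult: "x \<in> generated X \<Longrightarrow> y \<in> generated X \<Longrightarrow> x * y \<in> generated X"
  using subsemigroup_generated unfolding subsemigroup_def by blast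

lemma generated_self: "a \<in> generated {a}"
  using generated_incl[of "{a}"] by simp

lemma generated_least: "X \<subseteq> T \<Longrightarrow> subsemigroup T \<Longrightarrow> generated X \<subseteq> T"
  unfolding generated_def by (rule hull_minimal)

lemma generated_absorb:
  assumes "y \<in> generated {x}"
  shows "generated {x, y} = generated {x}"
proof
  show "generated {x, y} \<subseteq> generated {x}"
    using assms generated_incl[of "{x}"] subsemigroup_generated
    by (intro generated_least) auto
  show "generated {x} \<subseteq> generated {x, y}"
    using generated_incl[of "{x, y}"] subsemigroup_generated
    by (intro generated_least) auto
qed

lemma square_idempotent_if_cube:
  fixes a :: "'a::semigroup_mult"
  assumes "a * a * a \<in> {a, a * a}"
  shows "(a * a) * (a * a) = a * a"
proof -
  have "(a * a) * (a * a) = (a * a * a) * a"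
    by (simp only: mult.assoc)
  then show ?thesis
    using assms by (metis insert_iff empty_iff)
qed

lemma generated_if_cube:
  fixes a :: "'a::semigroup_mult"
  assumes "a * a * a \<in> {a, a * a}"
  shows "generated {a} = {a, a * a}"
proof
  have "a * (a * a) \<in> {a, a * a}"
    using assms by (simp only: mult.assoc)
  then have "subsemigroup {a, a * a}"
    using assms by (simp add: subsemigroup_def square_idempotent_if_cube[OF assms])
  then show "generated {a} \<subseteq> {a, a * a}"
    by (intro generated_least) blast+
  show "{a, a * a} \<subseteq> generated {a}"
    by (simp add: generated_self generated_mult)
qed

text \<open>
  If \<open>a\<^sup>3 \<notin> {a, a\<^sup>2}\<close>, then also \<open>a \<noteq> a\<^sup>2\<close>, so the first three powers of \<open>a\<close> are distinct and the
  order is at least \<open>3\<close>.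
\<close>

lemma element_order_le_2_iff:
  fixes a :: "'a::semigroup_mult"
  shows "element_order a \<in> {1, 2} \<longleftrightarrow> a * a * a \<in> {a, a * a}"
proof
  assume order: "element_order a \<in> {1, 2}"
  show "a * a * a \<in> {a, a * a}"
  proof (rule ccontr)
    assume new: "a * a * a \<notin> {a, a * a}"
    then have "a \<noteq> a * a"
      by (metis insert_iff)
    with new have distinct: "a \<notin> {a * a, a * a * a}" "a * a \<notin> {a * a * a}"
      by (metis insert_iff empty_iff)+
    have "card {a, a * a, a * a * a} = 3"
      using distinct by (simp only: card_insert_disjoint finite_insert finite.emptyI card.empty
        empty_iff not_False_eq_True numeral_3_eq_3)
    moreover have "{a, a * a, a * a * a} \<subseteq> generated {a}"
      by (simp add: generated_self generated_mult)
    moreover have "finite (generated {a})" "card (generated {a}) \<le> 2"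
      using order unfolding element_order_def
      by (auto split: if_splits simp: one_enat_def numeral_eq_enat)
    ultimately show False
      using card_mono[of "generated {a}" "{a, a * a, a * a * a}"] by linarith
  qed
next
  assume "a * a * a \<in> {a, a * a}"
  then have "generated {a} = {a, a * a}"
    by (rule generated_if_cube)
  then show "element_order a \<in> {1, 2}"
    unfolding element_order_def
    by (cases "a * a = a") (auto simp: one_enat_def numeral_eq_enat)
qed

section \<open>Adjacency in the cyclic graph\<close>

lemma adjacent_iff:
  "(x, y) \<in> parcs cyclic_graph \<longleftrightarrow> x \<noteq> y \<and> monogenic (generated {x, y})"
  by (simp add: cyclic_graph_def)

lemma adjacent_sym: "(x, y) \<in> parcs cyclic_graph \<Longrightarrow> (y, x) \<in> parcs cyclic_graph"
  by (auto simp: adjacent_iff insert_commute)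

lemma adjacent_if_generated:
  "x \<noteq> y \<Longrightarrow> y \<in> generated {x} \<Longrightarrow> (x, y) \<in> parcs cyclic_graph"
  unfolding adjacent_iff monogenic_def using generated_absorb by blast

text \<open>
  If \<open>a\<^sup>4\<close> is a new power as well, then \<open>a\<^sup>4 = (a\<^sup>2)\<^sup>2\<close> is adjacent to \<open>a\<^sup>2\<close>. Otherwise \<open>a\<^sup>4\<close> is
  \<open>a\<close>, \<open>a\<^sup>2\<close> or \<open>a\<^sup>3\<close>, and one of \<open>a\<^sup>2\<close>, \<open>a\<^sup>3\<close> is a power of the other: \<open>a\<^sup>3 = (a\<^sup>2)\<^sup>3\<close> when
  \<open>a\<^sup>4 = a\<close>, \<open>a\<^sup>2 = (a\<^sup>3)\<^sup>2\<close> when \<open>a\<^sup>4 = a\<^sup>2\<close>, and \<open>a\<^sup>3 = (a\<^sup>2)\<^sup>2\<close> when \<open>a\<^sup>4 = a\<^sup>3\<close>.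
\<close>

lemma triangle_if_cube_new:
  fixes a :: "'a::semigroup_mult"
  assumes new: "a * a * a \<notin> {a, a * a}"
  obtains x y z :: 'a where
    "(x, y) \<in> parcs cyclic_graph" "(y, z) \<in> parcs cyclic_graph" "(z, x) \<in> parcs cyclic_graph"
proof -
  let ?b = "a * a" and ?c = "a * a * a" and ?d = "a * a * a * a"
  have powers: "?b \<in> generated {a}" "?c \<in> generated {a}" "?d \<in> generated {a}"
    by (simp_all add: generated_self generated_mult)
  have "a \<noteq> ?b" "a \<noteq> ?c" and bc: "?b \<noteq> ?c"
    using new by (metis insert_iff)+
  then have ab: "(a, ?b) \<in> parcs cyclic_graph" and ca: "(?c, a) \<in> parcs cyclic_graph"
    using powers by (simp_all add: adjacent_if_generated adjacent_sym)
  have b_powers: "?b * ?b \<in> generated {?b}" "?b * ?b * ?b \<in> generated {?b}"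
    and c_power: "?c * ?c \<in> generated {?c}"
    by (intro generated_mult generated_self)+
  have d: "?b * ?b = ?d"
    by (simp only: mult.assoc)
  show thesis
  proof (cases "?d \<in> {a, ?b, ?c}")
    case True
    then consider "?d = a" | "?d = ?b" | "?d = ?c"
      by blast
    then have "?c \<in> generated {?b} \<or> ?b \<in> generated {?c}"
    proof cases
      case 1
      have "?b * ?b * ?b = ?d * a * a"
        by (simp only: mult.assoc)
      also have "\<dots> = ?c"
        by (simp only: 1)
      finally show ?thesis
        using b_powers(2) by metis
    next
      case 2
      have "?c * ?c = ?d * a * a"
        by (simp only: mult.assoc)
      also have "\<dots> = ?b"
        by (simp only: 2)
      finally show ?thesis
        using c_power by metis
    next
      case 3
      then show ?thesis
        using b_powers(1) d by metis
    qed
    then have "(?b, ?c) \<in> parcs cyclic_graph"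
      using bc adjacent_if_generated adjacent_sym by metis
    then show thesis
      using that ab ca by metis
  next
    case False
    then have "a \<noteq> ?d" "?b \<noteq> ?d"
      by (metis insert_iff)+
    moreover have "?d \<in> generated {?b}"
      using b_powers(1) d by metis
    ultimately have "(?d, a) \<in> parcs cyclic_graph" "(?b, ?d) \<in> parcs cyclic_graph"
      using powers(3) adjacent_if_generated adjacent_sym by metis+
    then show thesis
      using that ab by metis
  qed
qed

text \<open>
  A generator \<open>c\<close> of \<open>\<langle>x, y\<rangle>\<close> has \<open>\<langle>c\<rangle> = {c, c\<^sup>2}\<close>, so the distinct elements \<open>x\<close> and \<open>y\<close> are
  \<open>c\<close> and \<open>c\<^sup>2\<close> in some order. Since \<open>c\<^sup>3 \<in> {c, c\<^sup>2}\<close>, the element \<open>c\<^sup>2\<close> is idempotent.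
\<close>

lemma edge_is_square:
  fixes x y :: "'a::semigroup_mult"
  assumes cube: "\<And>a :: 'a. a * a * a \<in> {a, a * a}"
    and adj: "(x, y) \<in> parcs cyclic_graph"
  shows "(y = x * x \<and> x * x \<noteq> x \<and> y * y = y) \<or> (x = y * y \<and> y * y \<noteq> y \<and> x * x = x)"
proof -
  obtain c where c: "generated {x, y} = generated {c}" and neq: "x \<noteq> y"
    using adj unfolding adjacent_iff monogenic_def by blast
  have "{x, y} \<subseteq> {c, c * c}"
    using generated_incl[of "{x, y}"] c generated_if_cube[OF cube] by simp
  with neq have "(x = c \<and> y = c * c) \<or> (y = c \<and> x = c * c)"
    by auto
  moreover have "(c * c) * (c * c) = c * c"
    using cube by (rule square_idempotent_if_cube)
  ultimately show ?thesis
    using neq by (elim disjE conjE) simp_all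
qed

section \<open>Triangles, cycles and bipartitions\<close>

lemma not_acyclic_if_triangle:
  assumes "pair_wf_digraph G" "(x, y) \<in> parcs G" "(y, z) \<in> parcs G" "(z, x) \<in> parcs G"
    and "x \<noteq> y" "y \<noteq> z" "z \<noteq> x"
  shows "\<not> acyclic_graph G"
proof -
  interpret pair_wf_digraph G by fact
  have "cycle [(x, y), (y, z), (z, x)]"
    unfolding cycle_def using assms by (auto simp: awalk_simps in_arcsD1 in_arcsD2)
  then show ?thesis
    unfolding acyclic_graph_def by fastforce
qed

lemma not_bipartite_if_triangle:
  assumes "pair_wf_digraph G" "(x, y) \<in> parcs G" "(y, z) \<in> parcs G" "(z, x) \<in> parcs G"
  shows "\<not> bipartite_graph G"
proof
  interpret pair_wf_digraph G by fact
  assume "bipartite_graph G"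
  then obtain A B where parts: "pverts G = A \<union> B"
    and indep: "independent_in G A" "independent_in G B"
    unfolding bipartite_graph_def by blast
  have no_edge: "(p, q) \<notin> parcs G" if "p \<in> A \<and> q \<in> A \<or> p \<in> B \<and> q \<in> B" for p q
    using that indep unfolding independent_in_def by blast
  have "x \<in> A \<or> x \<in> B" "y \<in> A \<or> y \<in> B" "z \<in> A \<or> z \<in> B"
    using in_arcsD1[OF assms(2)] in_arcsD1[OF assms(3)] in_arcsD1[OF assms(4)]
    unfolding parts by simp_all
  \<comment> \<open>two of the three vertices lie in the same part\<close>
  then show False
    using no_edge[of x y] no_edge[of y z] no_edge[of z x] assms(2-4) by argo
qed

lemma bipartite_if_cubes:
  assumes cube: "\<And>a :: 'a::semigroup_mult. a * a * a \<in> {a, a * a}"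
  shows "bipartite_graph (cyclic_graph :: 'a pair_pre_digraph)"
proof -
  define E where "E = {x :: 'a. x * x = x}"
  have one_part: "(x \<in> E) \<noteq> (y \<in> E)" if "(x, y) \<in> parcs cyclic_graph" for x y
    using edge_is_square[OF cube that] unfolding E_def mem_Collect_eq by argo
  have verts: "pverts (cyclic_graph :: 'a pair_pre_digraph) = UNIV"
    by (simp add: cyclic_graph_def)
  have "independent_in cyclic_graph E" "independent_in cyclic_graph (- E)"
    unfolding independent_in_def verts using one_part by blast+
  then show ?thesis
    unfolding bipartite_graph_def verts by (intro exI[of _ E] exI[of _ "- E"]) simp
qed

text \<open>
  For consecutive vertices \<open>u, v, w, z\<close> of a cycle of length at least \<open>3\<close>, both \<open>u \<noteq> w\<close> and
  \<open>v \<noteq> z\<close> hold. One of \<open>v\<close>, \<open>w\<close> is not idempotent, so its two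
  neighbours on the cycle would both be its square.
\<close>

lemma acyclic_if_cubes:
  assumes cube: "\<And>a :: 'a::semigroup_mult. a * a * a \<in> {a, a * a}"
  shows "acyclic_graph (cyclic_graph :: 'a pair_pre_digraph)"
  unfolding acyclic_graph_def
proof
  interpret pair_sym_digraph "cyclic_graph :: 'a pair_pre_digraph"
    by (rule pair_sym_digraph_cyclic_graph)
  assume "\<exists>p. cycle p \<and> 3 \<le> length p"
  then obtain p u where walk: "awalk u p u" and dist: "distinct (tl (awalk_verts u p))"
    and "3 \<le> length p"
    unfolding cycle_def by blast
  then obtain e1 e2 e3 q where p: "p = e1 # e2 # e3 # q"
    by (auto simp: numeral_3_eq_3 Suc_le_length_iff)
  obtain v w z where e: "e1 = (u, v)" "e2 = (v, w)" "e3 = (w, z)"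
    using walk unfolding p by (cases e1; cases e2; cases e3) (auto simp: awalk_simps)
  have adj: "(u, v) \<in> parcs cyclic_graph" "(v, w) \<in> parcs cyclic_graph"
    "(w, z) \<in> parcs cyclic_graph"
    and rest: "awalk z q u"
    using walk unfolding p e by (auto simp: awalk_simps)
  have "distinct (v # w # awalk_verts z q)"
    using dist unfolding p e by simp
  moreover have "z \<in> set (awalk_verts z q)" "u \<in> set (awalk_verts z q)"
    using hd_in_awalk_verts(1)[OF rest] last_in_set[OF awalk_verts_non_Nil[of z q]] rest
    by simp_all
  ultimately have "u \<noteq> w" "v \<noteq> z"
    by auto
  then show False
    using edge_is_square[OF cube adj(1)] edge_is_square[OF cube adj(2)]
      edge_is_square[OF cube adj(3)] by metis
qed

theorem theorem3p8:
  shows "(range (element_order :: 'a::semigroup_mult \<Rightarrow> enat) \<subseteq> {1, 2}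
            \<longleftrightarrow> acyclic_graph (cyclic_graph :: 'a pair_pre_digraph))
       \<and> (acyclic_graph (cyclic_graph :: 'a pair_pre_digraph)
            \<longleftrightarrow> bipartite_graph (cyclic_graph :: 'a pair_pre_digraph))"
proof -
  let ?G = "cyclic_graph :: 'a pair_pre_digraph"
  let ?cubes = "\<forall>a :: 'a. a * a * a \<in> {a, a * a}"
  have wf: "pair_wf_digraph ?G"
    using pair_loopfree_digraph_cyclic_graph by (rule pair_loopfree_digraph.axioms)
  have orders: "range (element_order :: 'a \<Rightarrow> enat) \<subseteq> {1, 2} \<longleftrightarrow> ?cubes"
    unfolding element_order_le_2_iff[symmetric] by blast
  have "\<not> acyclic_graph ?G \<and> \<not> bipartite_graph ?G" if not_cubes: "\<not> ?cubes"
  proof -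
    obtain a :: 'a where "a * a * a \<notin> {a, a * a}"
      using not_cubes by blast
    then obtain x y z :: 'a where
      "(x, y) \<in> parcs cyclic_graph" "(y, z) \<in> parcs cyclic_graph" "(z, x) \<in> parcs cyclic_graph"
      by (rule triangle_if_cube_new)
    then show ?thesis
      using not_acyclic_if_triangle[OF wf] not_bipartite_if_triangle[OF wf]
      unfolding adjacent_iff by metis
  qed
  moreover have "acyclic_graph ?G \<and> bipartite_graph ?G" if ?cubes
    using that acyclic_if_cubes bipartite_if_cubes by blast
  ultimately show ?thesis
    using orders by blast
qed

end
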